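(* Let $D$ be an irreducible electron-photon Feynman diagram satisfying the Main condition: at each vertex of $D$ exactly two electron lines and one photon line meet, and of these three lines two are internal and one is external. Let $N_e, N_p$ be the numbers of external electron and external photon lines of $D$, $F_e, F_p$ the numbers of internal electron and internal photon lines of $D$, $n$ the number of vertices of $D$, and $\mathcal{Q}$ the number of contact points of $D$. Then the quantities $\mathcal{Q}, n, N_e, N_p$ are recovered from the internal quantities $F_e, F_p$ by $$\mathcal{Q}=2F_p,\qquad n=F_e+F_p,\qquad N_e=2F_p,\qquad N_p=F_e-F_p.$$
   Context: A Feynman diagram (electron-photon interaction) consists of finitely many vertices, directed external lines and undirected internal lines; every line is either an electron line or a photon line. An internal line connects two vertices (it has two ends, each at a vertex); an external line is attached to exactly one vertex, at which it begins or ends (outgoing or incoming). The diagram is irreducible if it cannot be split into two disconnected parts by removing an internal line. Under the Main condition, a vertex is called a contact point if an internal electron line and an internal photon line meet at it; equivalently, if an external (incoming or outgoing) electron line is attached to it. *)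

theory Defs
  imports Main "HOL-Library.Multiset"
begin

datatype line_kind = Electron | Photon

datatype direction = Incoming | Outgoing

text \<open>
  The two ends of an internal (undirected) line form a multiset of vertices of size two, so
  parallel lines are allowed, and so are lines with both ends at the same vertex.
\<close>

record ('v, 'i, 'x) diagram =
  verts :: "'v set"
  internal :: "'i set"
  external :: "'x set"
  ikind :: "'i \<Rightarrow> line_kind"
  xkind :: "'x \<Rightarrow> line_kind"
  ends :: "'i \<Rightarrow> 'v multiset"
  attach :: "'x \<Rightarrow> 'v"
  direction :: "'x \<Rightarrow> direction"

definition feynman_diagram :: "('v, 'i, 'x) diagram \<Rightarrow> bool" where
  "feynman_diagram D \<longleftrightarrow>
     finite (verts D) \<and> finite (internal D) \<and> finite (external D) \<and>
     (\<forall>l\<in>internal D. size (ends D l) = 2 \<and> set_mset (ends D l) \<subseteq> verts D) \<and>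
     (\<forall>x\<in>external D. attach D x \<in> verts D)"

definition disconnected :: "('v, 'i, 'x) diagram \<Rightarrow> bool" where
  "disconnected D \<longleftrightarrow>
     (\<exists>A B. A \<noteq> {} \<and> B \<noteq> {} \<and> A \<inter> B = {} \<and> A \<union> B = verts D \<and>
        (\<forall>l\<in>internal D. set_mset (ends D l) \<subseteq> A \<or> set_mset (ends D l) \<subseteq> B))"

definition remove_internal :: "'i \<Rightarrow> ('v, 'i, 'x) diagram \<Rightarrow> ('v, 'i, 'x) diagram" where
  "remove_internal l D = D\<lparr>internal := internal D - {l}\<rparr>"

definition irreducible_diagram :: "('v, 'i, 'x) diagram \<Rightarrow> bool" where
  "irreducible_diagram D \<longleftrightarrow> (\<forall>l\<in>internal D. \<not> disconnected (remove_internal l D))"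

definition internal_of :: "line_kind \<Rightarrow> ('v, 'i, 'x) diagram \<Rightarrow> 'i set" where
  "internal_of k D = {l \<in> internal D. ikind D l = k}"

definition external_of :: "line_kind \<Rightarrow> ('v, 'i, 'x) diagram \<Rightarrow> 'x set" where
  "external_of k D = {x \<in> external D. xkind D x = k}"

text \<open>
  Lines meeting at a vertex are counted by their ends there: an internal line with both ends
  at the vertex is counted twice.
\<close>

definition internal_at :: "line_kind \<Rightarrow> ('v, 'i, 'x) diagram \<Rightarrow> 'v \<Rightarrow> nat" where
  "internal_at k D v = (\<Sum>l\<in>internal_of k D. count (ends D l) v)"

definition external_at :: "line_kind \<Rightarrow> ('v, 'i, 'x) diagram \<Rightarrow> 'v \<Rightarrow> nat" where
  "external_at k D v = card {x \<in> external_of k D. attach D x = v}"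

definition main_condition :: "('v, 'i, 'x) diagram \<Rightarrow> bool" where
  "main_condition D \<longleftrightarrow>
     (\<forall>v\<in>verts D.
        internal_at Electron D v + external_at Electron D v = 2 \<and>
        internal_at Photon D v + external_at Photon D v = 1 \<and>
        internal_at Electron D v + internal_at Photon D v = 2 \<and>
        external_at Electron D v + external_at Photon D v = 1)"

definition contact_points :: "('v, 'i, 'x) diagram \<Rightarrow> 'v set" where
  "contact_points D =
     {v \<in> verts D. (\<exists>l\<in>internal_of Electron D. v \<in># ends D l) \<and>
                   (\<exists>m\<in>internal_of Photon D. v \<in># ends D m)}"

end

theory Submission imports Defs begin

text \<open>
  Summing the numbers of internal and external lines at a vertex over all vertices counts
  every internal line twice and every external line once. The Main condition leaves only two
  kinds of vertices: contact points, where one internal electron line, one internal photon line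
  and one external electron line meet, and vertices with two internal electron ends and one
  external photon line. All four identities are linear consequences of these sums.
\<close>

lemma sum_count_eq_size:
  assumes "finite A" "set_mset M \<subseteq> A"
  shows "(\<Sum>v\<in>A. count M v) = size M"
proof -
  have "(\<Sum>v\<in>set_mset M. count M v) = (\<Sum>v\<in>A. count M v)"
    by (rule sum.mono_neutral_left) (use assms in \<open>auto simp: not_in_iff\<close>)
  then show ?thesis
    by (simp add: size_multiset_overloaded_eq)
qed

text \<open>Double counting of line ends: after swapping the two sums, each line contributes the
  size of its multiset of ends, which is 2 even for a loop.\<close>

lemma sum_internal_at:
  assumes "feynman_diagram D"
  shows "(\<Sum>v\<in>verts D. internal_at k D v) = 2 * card (internal_of k D)"
proof -
  have "(\<Sum>v\<in>verts D. internal_at k D v)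
      = (\<Sum>l\<in>internal_of k D. \<Sum>v\<in>verts D. count (ends D l) v)"
    unfolding internal_at_def by (rule sum.swap)
  also have "\<dots> = (\<Sum>l\<in>internal_of k D. 2)"
    by (rule sum.cong)
      (use assms in \<open>auto simp: feynman_diagram_def internal_of_def sum_count_eq_size\<close>)
  finally show ?thesis by simp
qed

lemma sum_external_at:
  assumes "feynman_diagram D"
  shows "(\<Sum>v\<in>verts D. external_at k D v) = card (external_of k D)"
proof -
  have "finite (verts D)" "finite (external_of k D)" "attach D ` external_of k D \<subseteq> verts D"
    using assms by (auto simp: feynman_diagram_def external_of_def)
  then show ?thesis
    unfolding external_at_def
    \<comment> \<open>The fibres of \<open>attach D\<close> partition the external lines; summing
      the constant 1 turns this into an identity of cardinalities.\<close>
    using sum.group[of "external_of k D" "verts D" "attach D" "\<lambda>_. 1::nat"] by simp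
qed

lemma internal_at_pos_iff:
  assumes "feynman_diagram D"
  shows "internal_at k D v > 0 \<longleftrightarrow> (\<exists>l\<in>internal_of k D. v \<in># ends D l)"
proof -
  \<comment> \<open>Over an infinite set the sum in \<open>internal_at\<close> would be 0 by
    default, whatever its terms.\<close>
  have "finite (internal_of k D)"
    using assms by (simp add: feynman_diagram_def internal_of_def)
  then have "internal_at k D v = 0 \<longleftrightarrow> (\<forall>l\<in>internal_of k D. v \<notin># ends D l)"
    by (simp add: internal_at_def not_in_iff)
  then show ?thesis by (simp flip: neq0_conv)
qed

text \<open>Under the Main condition \<open>internal_at Photon D v\<close> is 0 or 1, and when it is
  1 exactly one internal electron end is left at \<open>v\<close>. It is thus the indicator function
  of the contact points.\<close>

lemma card_contact_points:
  assumes "feynman_diagram D" "main_condition D"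
  shows "card (contact_points D) = (\<Sum>v\<in>verts D. internal_at Photon D v)"
proof -
  have fin: "finite (verts D)"
    using assms(1) by (simp add: feynman_diagram_def)
  have "contact_points D
      = {v \<in> verts D. internal_at Electron D v > 0 \<and> internal_at Photon D v > 0}"
    unfolding contact_points_def internal_at_pos_iff[OF assms(1)] ..
  then have "card (contact_points D)
      = (\<Sum>v\<in>verts D. if internal_at Electron D v > 0 \<and> internal_at Photon D v > 0
          then 1 else 0)"
    using fin by (simp flip: sum.inter_filter)
  also have "\<dots> = (\<Sum>v\<in>verts D. internal_at Photon D v)"
  proof (rule sum.cong)
    fix v assume "v \<in> verts D"
    then have "internal_at Photon D v + external_at Photon D v = 1"
      "internal_at Electron D v + internal_at Photon D v = 2"
      using assms(2) by (auto simp: main_condition_def)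
    then show "(if internal_at Electron D v > 0 \<and> internal_at Photon D v > 0 then 1 else 0)
        = internal_at Photon D v"
      by auto
  qed simp
  finally show ?thesis .
qed

theorem mainTheorem2:
  fixes D :: "('v, 'i, 'x) diagram"
    and N_e N_p F_e F_p n Q :: nat
  assumes "feynman_diagram D"
    and "irreducible_diagram D"
    and "main_condition D"
    and "N_e = card (external_of Electron D)"
    and "N_p = card (external_of Photon D)"
    and "F_e = card (internal_of Electron D)"
    and "F_p = card (internal_of Photon D)"
    and "n = card (verts D)"
    and "Q = card (contact_points D)"
  shows "Q = 2 * F_p \<and> n = F_e + F_p \<and> N_e = 2 * F_p \<and> int N_p = int F_e - int F_p"
proof -
  note internal = sum_internal_at[OF assms(1)] and external = sum_external_at[OF assms(1)]
  have "(\<Sum>v\<in>verts D. internal_at Electron D v + internal_at Photon D v) = (\<Sum>v\<in>verts D. 2)"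
    by (rule sum.cong) (use assms(3) in \<open>auto simp: main_condition_def\<close>)
  then have n: "F_e + F_p = n"
    using assms(6-8) by (simp add: sum.distrib internal)
  have "(\<Sum>v\<in>verts D. external_at Electron D v + external_at Photon D v) = (\<Sum>v\<in>verts D. 1)"
    by (rule sum.cong) (use assms(3) in \<open>auto simp: main_condition_def\<close>)
  then have N: "N_e + N_p = n"
    using assms(4,5,8) by (simp add: sum.distrib external)
  \<comment> \<open>The sums agree term by term: at each vertex both numbers complement
    \<open>external_at Photon D v\<close> to 1.\<close>
  have "(\<Sum>v\<in>verts D. external_at Electron D v) = (\<Sum>v\<in>verts D. internal_at Photon D v)"
  proof (rule sum.cong)
    fix v assume "v \<in> verts D"
    then have "internal_at Photon D v + external_at Photon D v = 1"
      "external_at Electron D v + external_at Photon D v = 1"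
      using assms(3) by (auto simp: main_condition_def)
    then show "external_at Electron D v = internal_at Photon D v" by linarith
  qed simp
  then have N_e: "N_e = 2 * F_p"
    using assms(4,7) by (simp add: internal external)
  have "Q = 2 * F_p"
    using card_contact_points[OF assms(1,3)] assms(7,9) by (simp add: internal)
  \<comment> \<open>Equating the two expressions for \<open>n\<close> gives
    \<open>N_p + 2 * F_p = F_e + F_p\<close>, hence the value of \<open>N_p\<close>.\<close>
  with n N N_e show ?thesis by linarith
qed

end
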